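(* Let $X$ and $Y$ be compact Hausdorff spaces and suppose that $X$ is sequentially compact and that every component of $X$ is nowhere dense. Then every compatibility isomorphism $T\colon C(X)\to C(Y)$ is norm-continuous, i.e., continuous with respect to the supremum norms on $C(X)$ and $C(Y)$.
   Context: Fix a scalar field, either $\mathbb{R}$ or $\mathbb{C}$. For a topological space $X$, $C(X)$ denotes the set of all scalar-valued continuous functions on $X$. For a scalar-valued function $f$ on $X$, $\operatorname{supp} f$ is the closure of $\{x\in X\colon f(x)\neq 0\}$. The compatibility ordering on $C(X)$ is the partial order defined by: $f\preceq g$ if and only if $f(x)=g(x)$ for every $x\in\operatorname{supp} f$. A map $T\colon C(X)\to C(Y)$ (not assumed linear or continuous) is a compatibility morphism if $f\preceq g$ implies $Tf\preceq Tg$ for all $f,g\in C(X)$; a compatibility isomorphism is a bijective compatibility morphism whose inverse is also a compatibility morphism. The component of a point $x\in X$ is the union of all connected subspaces of $X$ containing $x$ (singletons are considered connected); a component of $X$ is the component of some point of $X$. *)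

theory Defs
  imports "HOL-Analysis.Analysis"
begin

definition sequentially_compact_space :: "'a topology \<Rightarrow> bool" where
  "sequentially_compact_space X \<longleftrightarrow>
     (\<forall>\<sigma> :: nat \<Rightarrow> 'a. range \<sigma> \<subseteq> topspace X \<longrightarrow>
        (\<exists>l r. strict_mono r \<and> limitin X (\<sigma> \<circ> r) l sequentially))"

definition nowhere_dense_in :: "'a topology \<Rightarrow> 'a set \<Rightarrow> bool" where
  "nowhere_dense_in X S \<longleftrightarrow> S \<subseteq> topspace X \<and> X interior_of (X closure_of S) = {}"

(* A function on X is a HOL function that is undefined off topspace X, so that equality
   of members of cont_funs X is equality of functions on X. *)
definition cont_funs :: "'a topology \<Rightarrow> ('a \<Rightarrow> 'k::real_normed_field) set" where
  "cont_funs X = {f \<in> extensional (topspace X). continuous_map X euclidean f}"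

definition supp_in :: "'a topology \<Rightarrow> ('a \<Rightarrow> 'k::zero) \<Rightarrow> 'a set" where
  "supp_in X f = X closure_of {x \<in> topspace X. f x \<noteq> 0}"

definition compat_le :: "'a topology \<Rightarrow> ('a \<Rightarrow> 'k::zero) \<Rightarrow> ('a \<Rightarrow> 'k) \<Rightarrow> bool" where
  "compat_le X f g \<longleftrightarrow> (\<forall>x \<in> supp_in X f. f x = g x)"

definition compat_morphism ::
  "'a topology \<Rightarrow> 'b topology \<Rightarrow> (('a \<Rightarrow> 'k::real_normed_field) \<Rightarrow> ('b \<Rightarrow> 'k)) \<Rightarrow> bool" where
  "compat_morphism X Y T \<longleftrightarrow>
     T \<in> cont_funs X \<rightarrow> cont_funs Y \<and>
     (\<forall>f \<in> cont_funs X. \<forall>g \<in> cont_funs X. compat_le X f g \<longrightarrow> compat_le Y (T f) (T g))"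

definition compat_isomorphism ::
  "'a topology \<Rightarrow> 'b topology \<Rightarrow> (('a \<Rightarrow> 'k::real_normed_field) \<Rightarrow> ('b \<Rightarrow> 'k)) \<Rightarrow> bool" where
  "compat_isomorphism X Y T \<longleftrightarrow>
     compat_morphism X Y T \<and>
     bij_betw T (cont_funs X) (cont_funs Y) \<and>
     compat_morphism Y X (inv_into (cont_funs X) T)"

(* cfunspace consists of the bounded continuous functions with the supremum metric; on a
   compact space boundedness is automatic, so this is C(X) with the supremum norm. *)
abbreviation sup_norm_topology ::
  "'a topology \<Rightarrow> ('a \<Rightarrow> 'k::real_normed_field) topology" where
  "sup_norm_topology X \<equiv> mtopology_of (cfunspace X euclidean_metric)"

lemma mspace_cfunspace_eq_cont_funs:
  fixes X :: "'a topology"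
  assumes "compact_space X"
  shows "mspace (cfunspace X (euclidean_metric :: 'k::real_normed_field metric)) = cont_funs X"
proof -
  have "bounded (f ` topspace X)"
    if "continuous_map X euclidean f" for f :: "'a \<Rightarrow> 'k"
    using image_compactin[OF _ that, of "topspace X"] assms
    by (simp add: compact_space_def compact_imp_bounded)
  then have "Metric_space.mbounded UNIV dist (f ` topspace X)"
    if "continuous_map X euclidean f" for f :: "'a \<Rightarrow> 'k"
    using that by simp
  then show ?thesis
    by (auto simp: cfunspace_def cont_funs_def Metric_space.fspace_def Met_TC.fspace_def)
qed

lemma topspace_sup_norm_topology:
  "compact_space X \<Longrightarrow> topspace (sup_norm_topology X) = cont_funs X"
  by (simp only: topspace_mtopology_of mspace_cfunspace_eq_cont_funs)

lemma mdist_cfunspace_eq_sup_norm: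
  fixes f g :: "'a \<Rightarrow> 'k::real_normed_field"
  assumes "compact_space X" "topspace X \<noteq> {}" "f \<in> cont_funs X" "g \<in> cont_funs X"
  shows "mdist (cfunspace X euclidean_metric) f g = (SUP x\<in>topspace X. norm (f x - g x))"
proof -
  have "f \<in> mspace (cfunspace X euclidean_metric)" "g \<in> mspace (cfunspace X euclidean_metric)"
    using assms by (simp_all only: mspace_cfunspace_eq_cont_funs)
  then show ?thesis
    using assms(2) by (simp add: cfunspace_def Met_TC.fdist_def dist_norm)
qed

end

theory Submission
  imports Defs
begin

text \<open>
  The proof works entirely with clopen sets; no correspondence between the points of \<open>X\<close> and
  those of \<open>Y\<close> is constructed. Write \<open>1\<^sub>U\<close> for the indicator of \<open>U\<close> and \<open>S\<close> for the inverse of \<open>T\<close>.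

  Below a fixed function \<open>g\<close>, the elements of the compatibility order are the restrictions of \<open>g\<close>
  to relatively clopen parts of its nonzero set. Applied to the constant \<open>1\<close> on \<open>Y\<close>, this turns
  every clopen \<open>U \<subseteq> X\<close> into a clopen \<open>V \<subseteq> Y\<close> such that \<open>T (f 1\<^sub>U) = (T f) 1\<^sub>V\<close> for all \<open>f\<close>
  (lemma \<open>T_cut_to\<close>): the values of \<open>T f\<close> on \<open>V\<close> depend only on those of \<open>f\<close> on \<open>U\<close>.
  In a compact Hausdorff space components are intersections of clopen sets, so nowhere density of
  the components says that every nonempty open set is split by some clopen set. This property
  passes from \<open>X\<close> to \<open>Y\<close>, and in \<open>Y\<close> it yields disjoint clopen sets meeting
  a subsequence of any given sequence of nonempty open sets.

  Suppose now that \<open>f\<^sub>n\<close> converges uniformly to \<open>f\<close> while \<open>T f\<^sub>n\<close> stays further than \<open>\<epsilon>\<close> from \<open>T f\<close>.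
  After passing to a subsequence there are points \<open>y\<^sub>n\<close> in disjoint clopen sets \<open>V\<^sub>n\<close> with
  \<open>\<bar>T f\<^sub>n - T f\<bar> > \<epsilon>\<close> at \<open>y\<^sub>n\<close>; let \<open>U\<^sub>n\<close> be the clopen subsets of \<open>X\<close> that correspond to the \<open>V\<^sub>n\<close>.
  For every set \<open>E\<close> of indices, replacing \<open>f\<close> by \<open>f\<^sub>n\<close> on \<open>U\<^sub>n\<close> for \<open>n \<in> E\<close> gives a continuous
  function \<open>g\<close>. Then \<open>min (\<bar>T g - T f\<bar> / \<epsilon>) 1\<close> is continuous on \<open>Y\<close>; on \<open>V\<^sub>n\<close> it vanishes if
  \<open>n \<notin> E\<close>, and if \<open>n \<in> E\<close> it agrees with a function \<open>\<beta>\<^sub>n\<close> that vanishes off \<open>V\<^sub>n\<close>, has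
  value \<open>1\<close> at \<open>y\<^sub>n\<close> and is independent of \<open>E\<close>.
  Applying \<open>S\<close> to its multiple by \<open>k\<close> shows that for every \<open>E\<close> some continuous function on \<open>X\<close>
  equals \<open>S (k \<beta>\<^sub>n)\<close> on \<open>U\<^sub>n\<close> for \<open>n \<in> E\<close> and \<open>0\<close> on the other \<open>U\<^sub>n\<close>. If the norms of the
  \<open>S (k \<beta>\<^sub>n)\<close> did not tend to \<open>0\<close>, sequential compactness of \<open>X\<close> would give a convergent
  sequence of points where they are large, and alternating membership in \<open>E\<close> along it contradicts
  continuity. So for each \<open>k\<close> the norms of \<open>S (k \<beta>\<^sub>n)\<close> tend to \<open>0\<close>, and indices \<open>n\<^sub>k\<close> can be chosen
  for which the disjointly supported functions \<open>S (k \<beta>\<^sub>n)\<close>, \<open>n = n\<^sub>k\<close>, have a continuous sum \<open>G\<close>. But \<open>T G\<close> has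
  norm \<open>k\<close> at the point \<open>y\<^sub>n\<close> with \<open>n = n\<^sub>k\<close>, so it is unbounded on the compact space \<open>Y\<close>.
\<close>

section \<open>Continuous functions and clopen sets\<close>

definition clopen_in :: "'a topology \<Rightarrow> 'a set \<Rightarrow> bool" where
  "clopen_in X U \<longleftrightarrow> closedin X U \<and> openin X U"

text \<open>
  For compact Hausdorff spaces this expresses that all components are nowhere dense, in a form
  without components, which a compatibility isomorphism can carry over from one space to another.
\<close>
definition clopens_split_opens :: "'a topology \<Rightarrow> bool" where
  "clopens_split_opens X \<longleftrightarrow>
     (\<forall>W. openin X W \<longrightarrow> W \<noteq> {} \<longrightarrow> (\<exists>U. clopen_in X U \<and> W \<inter> U \<noteq> {} \<and> W - U \<noteq> {}))"

definition cut_to :: "'a topology \<Rightarrow> 'a set \<Rightarrow> ('a \<Rightarrow> 'k::zero) \<Rightarrow> 'a \<Rightarrow> 'k" where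
  "cut_to X U f = (\<lambda>x\<in>topspace X. if x \<in> U then f x else 0)"

definition const_on :: "'a topology \<Rightarrow> 'k \<Rightarrow> 'a \<Rightarrow> 'k" where
  "const_on X c = (\<lambda>x\<in>topspace X. c)"

lemma cut_to_apply [simp]: "x \<in> topspace X \<Longrightarrow> cut_to X U f x = (if x \<in> U then f x else 0)"
  by (simp add: cut_to_def)

lemma const_on_apply [simp]: "x \<in> topspace X \<Longrightarrow> const_on X c x = c"
  by (simp add: const_on_def)

lemma clopen_in_Compl: "clopen_in X U \<Longrightarrow> clopen_in X (topspace X - U)"
  by (auto simp: clopen_in_def)

lemma clopen_in_Diff: "clopen_in X U \<Longrightarrow> clopen_in X V \<Longrightarrow> clopen_in X (U - V)"
  by (auto simp: clopen_in_def)

lemma clopen_in_Int: "clopen_in X U \<Longrightarrow> clopen_in X V \<Longrightarrow> clopen_in X (U \<inter> V)"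
  by (auto simp: clopen_in_def)

lemma clopen_in_Un: "clopen_in X U \<Longrightarrow> clopen_in X V \<Longrightarrow> clopen_in X (U \<union> V)"
  by (auto simp: clopen_in_def)

lemma clopen_in_topspace: "clopen_in X (topspace X)"
  by (auto simp: clopen_in_def)

lemma clopen_in_subset: "clopen_in X U \<Longrightarrow> U \<subseteq> topspace X"
  by (auto simp: clopen_in_def openin_subset)

lemma restrict_in_cont_funs:
  "continuous_map X euclidean f \<Longrightarrow> restrict f (topspace X) \<in> cont_funs X"
  using continuous_map_eq[of X euclidean f "restrict f (topspace X)"] by (auto simp: cont_funs_def)

lemma cont_funs_continuous: "f \<in> cont_funs X \<Longrightarrow> continuous_map X euclidean f"
  by (simp add: cont_funs_def)

lemma cont_funs_eqI:
  assumes "f \<in> cont_funs X" "g \<in> cont_funs X" "\<And>x. x \<in> topspace X \<Longrightarrow> f x = g x"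
  shows "f = g"
  using assms by (auto simp: cont_funs_def intro: extensionalityI)

lemma continuous_map_if_clopen:
  assumes U: "clopen_in X U"
    and f: "continuous_map X Z f" and g: "continuous_map X Z g"
  shows "continuous_map X Z (\<lambda>x. if x \<in> U then f x else g x)"
proof (rule continuous_map_cases)
  have "X frontier_of {x. x \<in> U} = {}"
    using U clopen_in_subset[OF U] by (simp add: clopen_in_def frontier_of_eq_empty)
  then show "\<And>x. x \<in> X frontier_of {x. x \<in> U} \<Longrightarrow> f x = g x" by blast
qed (use f g in \<open>auto intro: continuous_map_from_subtopology\<close>)

lemma cut_to_in_cont_funs:
  fixes f :: "'a \<Rightarrow> 'k::real_normed_field"
  assumes "clopen_in X U" "f \<in> cont_funs X"
  shows "cut_to X U f \<in> cont_funs X"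
  unfolding cut_to_def using assms
  by (auto intro!: restrict_in_cont_funs continuous_map_if_clopen dest: cont_funs_continuous)

lemma const_on_in_cont_funs:
  "const_on X (c::'k::real_normed_field) \<in> cont_funs X"
  unfolding const_on_def by (intro restrict_in_cont_funs) simp

lemma add_in_cont_funs:
  fixes f g :: "'a \<Rightarrow> 'k::real_normed_field"
  assumes "f \<in> cont_funs X" "g \<in> cont_funs X"
  shows "(\<lambda>x\<in>topspace X. f x + g x) \<in> cont_funs X"
  using assms by (intro restrict_in_cont_funs continuous_map_add cont_funs_continuous)

text \<open>
  The support may be replaced by the set where \<open>f\<close> does not vanish, since two continuous functions
  that agree on a set agree on its closure.
\<close>
lemma compat_le_iff:
  fixes f g :: "'a \<Rightarrow> 'k::real_normed_field"
  assumes f: "f \<in> cont_funs X" and g: "g \<in> cont_funs X"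
  shows "compat_le X f g \<longleftrightarrow> (\<forall>x\<in>topspace X. f x \<noteq> 0 \<longrightarrow> f x = g x)"
proof
  assume "compat_le X f g"
  moreover have "{x \<in> topspace X. f x \<noteq> 0} \<subseteq> supp_in X f"
    unfolding supp_in_def by (rule closure_of_subset) auto
  ultimately show "\<forall>x\<in>topspace X. f x \<noteq> 0 \<longrightarrow> f x = g x"
    by (auto simp: compat_le_def)
next
  assume *: "\<forall>x\<in>topspace X. f x \<noteq> 0 \<longrightarrow> f x = g x"
  have "closedin X {x \<in> topspace X. f x = g x}"
    using f g by (intro closedin_continuous_maps_eq[where Y=euclidean] cont_funs_continuous) auto
  then have "supp_in X f \<subseteq> {x \<in> topspace X. f x = g x}"
    unfolding supp_in_def using * by (intro closure_of_minimal) auto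
  then show "compat_le X f g"
    by (auto simp: compat_le_def)
qed

lemma cut_le:
  fixes f :: "'a \<Rightarrow> 'k::real_normed_field"
  shows "clopen_in X U \<Longrightarrow> f \<in> cont_funs X \<Longrightarrow> compat_le X (cut_to X U f) f"
  by (subst compat_le_iff) (auto simp: cut_to_in_cont_funs)

lemma openin_nonzero_set:
  fixes f :: "'a \<Rightarrow> 'k::real_normed_field"
  assumes "f \<in> cont_funs X"
  shows "openin X {x \<in> topspace X. f x \<noteq> 0}"
proof -
  have "openin X {x \<in> topspace X. f x \<in> - {0}}"
    by (rule openin_continuous_map_preimage[OF cont_funs_continuous[OF assms]]) auto
  then show ?thesis by simp
qed

text \<open>
  A function below the constant \<open>1\<close> takes only the values \<open>0\<close> and \<open>1\<close>.
\<close>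
lemma clopen_in_nonzero_set:
  fixes e :: "'a \<Rightarrow> 'k::real_normed_field"
  assumes e: "e \<in> cont_funs X" "compat_le X e (const_on X 1)"
  shows "clopen_in X {x \<in> topspace X. e x \<noteq> 0}"
proof -
  have "{x \<in> topspace X. e x \<noteq> 0} = {x \<in> topspace X. e x \<in> {1}}"
    using e by (auto simp: compat_le_iff const_on_in_cont_funs)
  moreover have "closedin X {x \<in> topspace X. e x \<in> {1}}"
    by (rule closedin_continuous_map_preimage[OF cont_funs_continuous[OF e(1)]]) auto
  ultimately show ?thesis
    using openin_nonzero_set[OF e(1)] by (simp add: clopen_in_def)
qed

section \<open>The action of a compatibility isomorphism on clopen sets\<close>

text \<open>
  The inverse is a parameter of its own, so that every result about \<open>T\<close> has a counterpart for \<open>S\<close>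
  by exchanging the two.
\<close>
locale compat_iso =
  fixes X :: "'a topology" and Y :: "'b topology"
    and T :: "('a \<Rightarrow> 'k::real_normed_field) \<Rightarrow> 'b \<Rightarrow> 'k" and S :: "('b \<Rightarrow> 'k) \<Rightarrow> 'a \<Rightarrow> 'k"
  assumes T_in: "f \<in> cont_funs X \<Longrightarrow> T f \<in> cont_funs Y"
    and S_in: "g \<in> cont_funs Y \<Longrightarrow> S g \<in> cont_funs X"
    and S_T: "f \<in> cont_funs X \<Longrightarrow> S (T f) = f"
    and T_S: "g \<in> cont_funs Y \<Longrightarrow> T (S g) = g"
    and T_mono: "f \<in> cont_funs X \<Longrightarrow> f' \<in> cont_funs X \<Longrightarrow> compat_le X f f' \<Longrightarrow> compat_le Y (T f) (T f')"
    and S_mono: "g \<in> cont_funs Y \<Longrightarrow> g' \<in> cont_funs Y \<Longrightarrow> compat_le Y g g' \<Longrightarrow> compat_le X (S g) (S g')"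

lemma compat_iso_of_compat_isomorphism:
  assumes "compat_isomorphism X Y T"
  shows "compat_iso X Y T (inv_into (cont_funs X) T)"
  using assms unfolding compat_isomorphism_def compat_morphism_def
  by unfold_locales (auto simp: bij_betw_def f_inv_into_f)

context compat_iso
begin

lemma inverse: "compat_iso Y X S T"
  by unfold_locales (simp_all add: T_in S_in S_T T_S T_mono S_mono)

lemma T_zero: "T (const_on X 0) = const_on Y 0"
proof -
  let ?z = "const_on X (0::'k)" and ?w = "const_on Y (0::'k)"
  have "compat_le X ?z (S ?w)"
    by (subst compat_le_iff) (auto simp: S_in const_on_in_cont_funs)
  then have "compat_le Y (T ?z) (T (S ?w))"
    by (intro T_mono) (auto simp: S_in const_on_in_cont_funs)
  then have "compat_le Y (T ?z) ?w"
    by (simp add: T_S const_on_in_cont_funs)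
  then show ?thesis
    by (intro cont_funs_eqI[where X=Y] T_in const_on_in_cont_funs)
      (force simp: compat_le_iff T_in const_on_in_cont_funs)
qed

lemma S_le: "f \<in> cont_funs X \<Longrightarrow> g \<in> cont_funs Y \<Longrightarrow> compat_le Y g (T f) \<Longrightarrow> compat_le X (S g) f"
  using S_mono[of g "T f"] by (simp add: T_in S_T)

lemma le_S: "f \<in> cont_funs X \<Longrightarrow> g \<in> cont_funs Y \<Longrightarrow> compat_le Y (T f) g \<Longrightarrow> compat_le X f (S g)"
  using S_mono[of "T f" g] by (simp add: T_in S_T)

lemma T_le: "f \<in> cont_funs X \<Longrightarrow> g \<in> cont_funs Y \<Longrightarrow> compat_le X f (S g) \<Longrightarrow> compat_le Y (T f) g"
  using T_mono[of f "S g"] by (simp add: S_in T_S)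

lemma T_cut_le_one:
  assumes "clopen_in X W"
  shows "compat_le Y (T (cut_to X W (S (const_on Y 1)))) (const_on Y 1)"
  using assms by (intro T_le cut_to_in_cont_funs cut_le S_in const_on_in_cont_funs)

text \<open>
  Let \<open>p\<close> and \<open>q\<close> be the restrictions of \<open>f\<close> to \<open>U\<close> and of \<open>S 1\<close> to \<open>W\<close>. They are disjoint, so only
  \<open>0\<close> lies below both, and they have the upper bound \<open>p + q\<close>. Hence \<open>T p\<close> and \<open>T q\<close> agree where
  neither vanishes. As \<open>T q\<close> is an indicator function, the restriction of \<open>T p\<close> to the
  nonzero set of \<open>T q\<close> is continuous; it lies below both \<open>T p\<close> and \<open>T q\<close> and is therefore \<open>0\<close>.
\<close>
lemma T_cut_disjoint:
  assumes U: "clopen_in X U" and W: "clopen_in X W" and "U \<inter> W = {}"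
    and f: "f \<in> cont_funs X" and y: "y \<in> topspace Y"
    and ne: "T (cut_to X W (S (const_on Y 1))) y \<noteq> 0"
  shows "T (cut_to X U f) y = 0"
proof -
  let ?p = "cut_to X U f" and ?q = "cut_to X W (S (const_on Y (1::'k)))"
  have p: "?p \<in> cont_funs X" and q: "?q \<in> cont_funs X"
    using U W f by (auto intro!: cut_to_in_cont_funs S_in const_on_in_cont_funs)
  define u where "u = (\<lambda>x\<in>topspace X. ?p x + ?q x)"
  have u: "u \<in> cont_funs X"
    unfolding u_def using p q by (rule add_in_cont_funs)
  have "compat_le X ?p u" "compat_le X ?q u"
    using \<open>U \<inter> W = {}\<close> by (auto simp: compat_le_iff p q u) (auto simp: u_def split: if_splits)
  then have "compat_le Y (T ?p) (T u)" "compat_le Y (T ?q) (T u)"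
    by (auto intro: T_mono p q u)
  then have Tpq: "T ?p z = T ?q z" if "z \<in> topspace Y" "T ?p z \<noteq> 0" "T ?q z \<noteq> 0" for z
    using that by (auto simp: compat_le_iff T_in p q u intro: trans[OF _ sym])
  define V where "V = {z \<in> topspace Y. T ?q z \<noteq> 0}"
  have V: "clopen_in Y V"
    unfolding V_def by (intro clopen_in_nonzero_set T_in q T_cut_le_one W)
  define k where "k = cut_to Y V (T ?p)"
  have k: "k \<in> cont_funs Y"
    unfolding k_def by (intro cut_to_in_cont_funs V T_in p)
  have "compat_le Y k (T ?p)"
    unfolding k_def by (intro cut_le V T_in p)
  then have kp: "compat_le X (S k) ?p"
    by (intro S_le p k)
  have "compat_le Y k (T ?q)"
    using Tpq by (auto simp: compat_le_iff k T_in q) (auto simp: k_def V_def split: if_splits)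
  then have kq: "compat_le X (S k) ?q"
    by (intro S_le q k)
  have "S k = const_on X 0"
    using kp kq \<open>U \<inter> W = {}\<close>
    by (intro cont_funs_eqI[where X=X] S_in k const_on_in_cont_funs)
      (force simp: compat_le_iff S_in k p q const_on_in_cont_funs split: if_splits)
  then have "k = const_on Y 0"
    using T_zero T_S[OF k] by simp
  then have "k y = 0"
    using y by simp
  then show ?thesis
    using y ne by (simp add: k_def V_def)
qed

text \<open>
  With \<open>h = S 1\<close>, the functions \<open>T (h 1\<^sub>U)\<close> and \<open>T (h 1\<^sub>U\<^sub>')\<close>, where \<open>U'\<close> is the complement of \<open>U\<close>, lie
  below \<open>1\<close> and so are the indicators of clopen sets \<open>V\<close> and \<open>V'\<close>. These cover \<open>Y\<close>, because \<open>h\<close> is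
  the least upper bound of its two parts. By disjointness \<open>T (f 1\<^sub>U)\<close> vanishes on \<open>V'\<close> and
  \<open>T (f 1\<^sub>U\<^sub>')\<close> on \<open>V\<close>, and \<open>T f\<close> is the least upper bound, that is, the sum, of the two.
\<close>
lemma T_cut_to:
  assumes U: "clopen_in X U"
  obtains V where "clopen_in Y V" "\<And>f. f \<in> cont_funs X \<Longrightarrow> T (cut_to X U f) = cut_to Y V (T f)"
proof -
  let ?U' = "topspace X - U"
  have U': "clopen_in X ?U'"
    using U by (rule clopen_in_Compl)
  define h where "h = S (const_on Y (1::'k))"
  have h: "h \<in> cont_funs X"
    unfolding h_def by (intro S_in const_on_in_cont_funs)
  let ?e = "T (cut_to X U h)" and ?e' = "T (cut_to X ?U' h)"
  define V where "V = {y \<in> topspace Y. ?e y \<noteq> 0}"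
  define V' where "V' = {y \<in> topspace Y. ?e' y \<noteq> 0}"
  have e: "?e \<in> cont_funs Y" and e': "?e' \<in> cont_funs Y"
    by (auto intro: T_in cut_to_in_cont_funs U U' h)
  have e1: "compat_le Y ?e (const_on Y 1)" "compat_le Y ?e' (const_on Y 1)"
    unfolding h_def by (auto intro: T_cut_le_one U U')
  have V: "clopen_in Y V" "clopen_in Y V'"
    unfolding V_def V'_def by (auto intro: clopen_in_nonzero_set e e' e1)
  \<comment> \<open>The indicator of \<open>V \<union> V'\<close> is above both parts of \<open>T h = 1\<close>, hence above \<open>1\<close> itself.\<close>
  define m where "m = cut_to Y (V \<union> V') (const_on Y (1::'k))"
  have m: "m \<in> cont_funs Y"
    unfolding m_def by (intro cut_to_in_cont_funs clopen_in_Un V const_on_in_cont_funs)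
  have "compat_le Y ?e m" "compat_le Y ?e' m"
    using e1 by (auto simp: compat_le_iff e e' m const_on_in_cont_funs)
      (auto simp: m_def V_def V'_def)
  then have "compat_le X (cut_to X U h) (S m)" "compat_le X (cut_to X ?U' h) (S m)"
    by (auto intro: le_S m cut_to_in_cont_funs U U' h)
  then have "compat_le X h (S m)"
    by (simp add: compat_le_iff h S_in m cut_to_in_cont_funs U U') (force split: if_splits)
  then have "compat_le Y (const_on Y 1) m"
    using T_le[OF h m] by (simp add: h_def T_S const_on_in_cont_funs)
  then have cover: "y \<in> V \<or> y \<in> V'" if "y \<in> topspace Y" for y
  proof -
    have "m y = 1"
      using \<open>compat_le Y (const_on Y 1) m\<close> that by (simp add: compat_le_iff const_on_in_cont_funs m)
    then show ?thesis
      using that by (simp add: m_def split: if_splits)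
  qed
  show ?thesis
  proof (rule that[OF V(1)])
    fix f :: "'a \<Rightarrow> 'k" assume f: "f \<in> cont_funs X"
    let ?p = "cut_to X U f" and ?p' = "cut_to X ?U' f"
    have p: "?p \<in> cont_funs X" "?p' \<in> cont_funs X"
      by (auto intro: cut_to_in_cont_funs U U' f)
    have pV: "T ?p y = 0" if "y \<in> V'" for y
      using that T_cut_disjoint[OF U U' _ f] by (auto simp: V'_def h_def)
    have p'V: "T ?p' y = 0" if "y \<in> V" for y
      using that T_cut_disjoint[OF U' U _ f] by (auto simp: V_def h_def)
    define u where "u = (\<lambda>y\<in>topspace Y. T ?p y + T ?p' y)"
    have u: "u \<in> cont_funs Y"
      unfolding u_def by (intro add_in_cont_funs T_in p)
    have "compat_le Y (T ?p) u" "compat_le Y (T ?p') u"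
      using cover pV p'V by (auto simp: compat_le_iff T_in p u) (force simp: u_def)+
    then have "compat_le X ?p (S u)" "compat_le X ?p' (S u)"
      by (auto intro: le_S u p)
    then have "compat_le X f (S u)"
      by (simp add: compat_le_iff f S_in u p) (force split: if_splits)
    then have fu: "compat_le Y (T f) u"
      by (intro T_le f u)
    have pf: "compat_le Y (T ?p) (T f)"
      by (intro T_mono p f cut_le U)
    show "T ?p = cut_to Y V (T f)"
    proof (rule cont_funs_eqI[where X=Y])
      fix y assume y: "y \<in> topspace Y"
      show "T ?p y = cut_to Y V (T f) y"
      proof (cases "y \<in> V")
        case True
        then have "u y = T ?p y"
          using y p'V by (simp add: u_def)
        then show ?thesis
          using y True fu pf by (fastforce simp: compat_le_iff T_in p f u)
      next
        case False
        then show ?thesis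
          using y cover[OF y] pV by auto
      qed
    qed (auto intro: T_in p cut_to_in_cont_funs V f)
  qed
qed

lemma S_cut_to:
  assumes "clopen_in Y V"
  obtains U where "clopen_in X U" "\<And>g. g \<in> cont_funs Y \<Longrightarrow> S (cut_to Y V g) = cut_to X U (S g)"
  using compat_iso.T_cut_to[OF inverse assms] by blast

text \<open>
  A nonempty open subset of \<open>Y\<close> contains the nonzero set of some \<open>v \<noteq> 0\<close>. A clopen set splitting the nonzero
  set of \<open>S v\<close> decomposes \<open>S v\<close> into two nonzero parts, and \<open>T\<close> maps these to the nonzero parts of
  \<open>v\<close> cut out by the corresponding clopen subset of \<open>Y\<close>.
\<close>
lemma clopens_split_opens_transfer:
  assumes split: "clopens_split_opens X"
    and Y: "compact_space Y" "Hausdorff_space Y"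
  shows "clopens_split_opens Y"
  unfolding clopens_split_opens_def
proof (intro allI impI)
  fix W assume W: "openin Y W" "W \<noteq> {}"
  obtain z where z: "z \<in> W" using W by blast
  then have zY: "z \<in> topspace Y" using W openin_subset by blast
  have "normal_space Y"
    using Y by (simp add: compact_Hausdorff_or_regular_imp_normal_space)
  moreover have "closedin Y (topspace Y - W)" "closedin Y {z}"
    using W Y zY by (auto simp: closedin_Hausdorff_sing_eq)
  ultimately obtain t where t: "continuous_map Y euclideanreal t"
    "t ` (topspace Y - W) \<subseteq> {0}" "t ` {z} \<subseteq> {1}"
    by (rule Urysohn_lemma_alt[where a=0 and b=1]) (use z in \<open>auto simp: disjnt_def\<close>)
  define v where "v = (\<lambda>y\<in>topspace Y. of_real (t y) :: 'k)"
  have v: "v \<in> cont_funs Y"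
    unfolding v_def using t(1)
    by (intro restrict_in_cont_funs) (simp add: continuous_map_atin tendsto_of_real)
  have v_off: "v y = 0" if "y \<in> topspace Y" "y \<notin> W" for y
    using that t(2) by (auto simp: v_def)
  have v_z: "v z = 1" using t(3) zY by (simp add: v_def)
  define W' where "W' = {x \<in> topspace X. S v x \<noteq> 0}"
  have "W' \<noteq> {}"
  proof
    assume "W' = {}"
    then have "S v = const_on X 0"
      by (intro cont_funs_eqI[where X=X] S_in v const_on_in_cont_funs) (auto simp: W'_def)
    then have "v = const_on Y 0" using T_zero T_S[OF v] by simp
    then show False using v_z zY by simp
  qed
  moreover have "openin X W'"
    unfolding W'_def by (intro openin_nonzero_set S_in v)
  ultimately obtain U a b where U: "clopen_in X U"
    and a: "a \<in> W'" "a \<in> U" and b: "b \<in> W'" "b \<notin> U"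
    using split unfolding clopens_split_opens_def by blast
  obtain V where V: "clopen_in Y V"
    and TV: "\<And>f. f \<in> cont_funs X \<Longrightarrow> T (cut_to X U f) = cut_to Y V (T f)"
    using T_cut_to[OF U] by blast
  have cut: "T (cut_to X U (S v)) = cut_to Y V v"
    using TV[OF S_in[OF v]] T_S[OF v] by simp
  have SC: "cut_to X U (S v) \<in> cont_funs X"
    by (intro cut_to_in_cont_funs U S_in v)
  have "W \<inter> V \<noteq> {}"
  proof
    assume "W \<inter> V = {}"
    then have "cut_to Y V v = const_on Y 0"
      using v_off by (intro cont_funs_eqI[where X=Y] cut_to_in_cont_funs V v const_on_in_cont_funs) auto
    then have "T (cut_to X U (S v)) = T (const_on X 0)"
      using cut T_zero by simp
    then have "cut_to X U (S v) = const_on X 0"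
      by (metis S_T SC const_on_in_cont_funs)
    from fun_cong[OF this, of a] show False
      using a by (simp add: W'_def)
  qed
  moreover have "W - V \<noteq> {}"
  proof
    assume "W - V = {}"
    then have "cut_to Y V v = v"
      using v_off by (intro cont_funs_eqI[where X=Y] cut_to_in_cont_funs V v) auto
    then have "cut_to X U (S v) = S v"
      by (metis S_T SC cut)
    from fun_cong[OF this, of b] show False
      using b by (simp add: W'_def)
  qed
  ultimately show "\<exists>V. clopen_in Y V \<and> W \<inter> V \<noteq> {} \<and> W - V \<noteq> {}" using V by blast
qed

end

section \<open>Sequences of disjoint clopen sets\<close>

text \<open>
  An open set split by no clopen set lies in one quasi-component, which in a compact Hausdorff
  space is a component.
\<close>
lemma clopens_split_opens_if_nowhere_dense:
  assumes X: "compact_space X" "Hausdorff_space X"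
    and nd: "\<forall>K \<in> connected_components_of X. nowhere_dense_in X K"
  shows "clopens_split_opens X"
  unfolding clopens_split_opens_def
proof (intro allI impI, rule ccontr)
  fix W assume W: "openin X W" "W \<noteq> {}"
    and no: "\<not> (\<exists>U. clopen_in X U \<and> W \<inter> U \<noteq> {} \<and> W - U \<noteq> {})"
  obtain z where z: "z \<in> W" using W by blast
  let ?K = "quasi_component_of_set X z"
  have WX: "W \<subseteq> topspace X" using W openin_subset by blast
  have "W \<subseteq> ?K"
    using no z WX unfolding quasi_component_of_def clopen_in_def by blast
  moreover have "?K \<in> quasi_components_of X"
    using z WX by (auto simp: quasi_component_in_quasi_components_of)
  then have "?K \<in> connected_components_of X"
    using quasi_eq_connected_components_of X by metis
  then have "?K \<subseteq> topspace X" "X interior_of (X closure_of ?K) = {}"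
    using nd by (auto simp: nowhere_dense_in_def)
  ultimately have "W \<subseteq> X closure_of ?K"
    using closure_of_subset by blast
  then have "W \<subseteq> X interior_of (X closure_of ?K)"
    using W interior_of_maximal by blast
  then show False
    using \<open>X interior_of (X closure_of ?K) = {}\<close> W by blast
qed

text \<open>
  Keep a clopen remainder \<open>W\<close> that meets infinitely many of the given open sets. Splitting
  \<open>A n \<inter> W\<close> for one such \<open>n\<close> divides \<open>W\<close> into two clopen parts that both meet \<open>A n\<close>. One of
  them meets infinitely many of the open sets and becomes the new remainder; the other one is
  the next clopen set of the sequence.
\<close>
lemma disjoint_clopens_meeting_opens:
  fixes A :: "nat \<Rightarrow> 'b set"
  assumes split: "clopens_split_opens Y"
    and A: "\<And>n. openin Y (A n)" "\<And>n. A n \<noteq> {}"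
  obtains r :: "nat \<Rightarrow> nat" and V where "strict_mono r" "\<And>k. clopen_in Y (V k)" "disjoint_family V"
    "\<And>k. A (r k) \<inter> V k \<noteq> {}"
proof -
  \<comment> \<open>A state \<open>(W, n, V)\<close> consists of the remainder, the index chosen last and its clopen set.\<close>
  define P where "P = (\<lambda>(W, n, V). clopen_in Y W \<and> clopen_in Y V \<and> V \<inter> W = {} \<and>
    infinite {m. A m \<inter> W \<noteq> {}} \<and> A n \<inter> V \<noteq> {})"
  define Q where "Q = (\<lambda>(W :: 'b set, n, V :: 'b set) (W', n' :: nat, V'). W' \<subseteq> W \<and> V' \<subseteq> W \<and> (n :: nat) < n')"
  have step: "\<exists>W' n' V'. P (W', n', V') \<and> W' \<subseteq> W \<and> V' \<subseteq> W \<and> N < n'"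
    if W: "clopen_in Y W" and inf: "infinite {m. A m \<inter> W \<noteq> {}}" for W N
  proof -
    obtain n where n: "N < n" "A n \<inter> W \<noteq> {}"
      using inf unfolding infinite_nat_iff_unbounded by blast
    have "openin Y (A n \<inter> W)"
      using A W by (auto simp: clopen_in_def)
    then obtain U where U: "clopen_in Y U" "A n \<inter> W \<inter> U \<noteq> {}" "A n \<inter> W - U \<noteq> {}"
      using split n unfolding clopens_split_opens_def by metis
    have "{m. A m \<inter> W \<noteq> {}} = {m. A m \<inter> (W \<inter> U) \<noteq> {}} \<union> {m. A m \<inter> (W - U) \<noteq> {}}"
      by blast
    with inf consider "infinite {m. A m \<inter> (W \<inter> U) \<noteq> {}}" | "infinite {m. A m \<inter> (W - U) \<noteq> {}}"
      by (metis finite_Un)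
    then show ?thesis
    proof cases
      case 1
      then have "P (W \<inter> U, n, W - U)"
        using U W by (auto simp: P_def clopen_in_Int clopen_in_Diff)
      then show ?thesis using n by blast
    next
      case 2
      then have "P (W - U, n, W \<inter> U)"
        using U W by (auto simp: P_def clopen_in_Int clopen_in_Diff)
      then show ?thesis using n by blast
    qed
  qed
  have "A m \<inter> topspace Y \<noteq> {}" for m
    using A openin_subset by blast
  then have "infinite {m. A m \<inter> topspace Y \<noteq> {}}" by simp
  then have "\<exists>s. P s"
    using step[OF clopen_in_topspace] by blast
  moreover have "\<exists>s'. P s' \<and> Q s s'" if "P s" for s
  proof -
    obtain W n V where s: "s = (W, n, V)" by (cases s)
    then have "clopen_in Y W" "infinite {m. A m \<inter> W \<noteq> {}}"
      using that by (auto simp: P_def)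
    from step[OF this, of n] obtain W' n' V' where
      "P (W', n', V')" "W' \<subseteq> W" "V' \<subseteq> W" "n < n'" by blast
    then show ?thesis
      using s by (intro exI[of _ "(W', n', V')"]) (simp add: Q_def)
  qed
  ultimately obtain s where s: "\<And>k. P (s k)" "\<And>k. Q (s k) (s (Suc k))"
    using dependent_nat_choice[of "\<lambda>_. P" "\<lambda>_. Q"] by blast
  define W where "W k = fst (s k)" for k
  define r where "r k = fst (snd (s k))" for k
  define V where "V k = snd (snd (s k))" for k
  have sk: "s k = (W k, r k, V k)" for k
    by (simp add: W_def r_def V_def)
  have Pk: "clopen_in Y (V k)" "V k \<inter> W k = {}" "A (r k) \<inter> V k \<noteq> {}" for k
    using s(1)[of k] by (auto simp: P_def sk)
  have Qk: "W (Suc k) \<subseteq> W k" "V (Suc k) \<subseteq> W k" "r k < r (Suc k)" for k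
    using s(2)[of k] by (auto simp: Q_def sk)
  have anti: "W k \<subseteq> W j" if "j \<le> k" for j k
    using Qk(1) that by (rule lift_Suc_antimono_le)
  have dis: "V j \<inter> V k = {}" if "j < k" for j k
  proof -
    obtain i where "k = Suc (j + i)"
      using less_imp_Suc_add[OF \<open>j < k\<close>] by blast
    then have "V k \<subseteq> W (j + i)" using Qk(2)[of "j + i"] by simp
    also have "\<dots> \<subseteq> W j" by (rule anti) simp
    finally have "V k \<subseteq> W j" .
    then show ?thesis using Pk(2)[of j] by (metis Int_mono order_refl subset_empty)
  qed
  have "disjoint_family V"
    unfolding disjoint_family_on_def using dis by (metis inf_commute linorder_neqE_nat)
  moreover have "strict_mono r"
    using Qk(3) by (simp add: strict_mono_Suc_iff)
  ultimately show ?thesis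
    by (intro that[of r V] Pk)
qed

text \<open>
  Replacing \<open>f\<close> by \<open>p n\<close> on finitely many of the \<open>U n\<close> leaves a continuous function, and these
  functions converge uniformly. The \<open>U n\<close> may accumulate anywhere.
\<close>
lemma glue_on_disjoint_clopens:
  fixes f :: "'a \<Rightarrow> 'k::real_normed_field" and p :: "nat \<Rightarrow> 'a \<Rightarrow> 'k"
  assumes U: "\<And>n. clopen_in X (U n)" and dis: "disjoint_family U"
    and f: "f \<in> cont_funs X" and p: "\<And>n. p n \<in> cont_funs X"
    and lim: "\<And>e. 0 < e \<Longrightarrow> \<forall>\<^sub>F n in sequentially. \<forall>x\<in>U n. norm (p n x - f x) < e"
  obtains g where "g \<in> cont_funs X" "\<And>n x. x \<in> U n \<Longrightarrow> g x = p n x"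
proof -
  define g where "g x = (if \<exists>n. x \<in> U n then p (THE n. x \<in> U n) x else f x)" for x
  \<comment> \<open>\<open>q N\<close> results from \<open>f\<close> by the replacements on \<open>U n\<close> for \<open>n < N\<close>.\<close>
  define q where "q = rec_nat f (\<lambda>n h x. if x \<in> U n then p n x else h x)"
  have q_Suc: "q (Suc n) = (\<lambda>x. if x \<in> U n then p n x else q n x)" for n
    by (simp add: q_def fun_eq_iff)
  have q_cont: "continuous_map X euclidean (q n)" for n
  proof (induction n)
    case 0
    then show ?case using f by (simp add: q_def cont_funs_continuous)
  next
    case (Suc n)
    then show ?case
      unfolding q_Suc by (rule continuous_map_if_clopen[OF U cont_funs_continuous[OF p]])
  qed
  have the: "(THE n. x \<in> U n) = n" if "x \<in> U n" for n x
    using dis that by (intro the_equality) (auto simp: disjoint_family_on_def)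
  have g_U: "g x = p n x" if "x \<in> U n" for n x
    using that the[OF that] by (auto simp: g_def)
  have q_lt: "q N x = p n x" if "x \<in> U n" "n < N" for n N x
    using that(2)
  proof (induction N)
    case (Suc N)
    then show ?case
      using the[OF that(1)] the[of x N] that(1) by (auto simp: q_Suc less_Suc_eq)
  qed simp
  have q_ge: "q N x = f x" if "\<And>n. n < N \<Longrightarrow> x \<notin> U n" for N x
    using that by (induction N) (auto simp: q_Suc q_def)
  have "continuous_map X Met_TC.mtopology g"
  proof (rule Met_TC.continuous_map_uniform_limit[where F=sequentially and f=q])
    fix e :: real assume "0 < e"
    then obtain N where N: "\<And>n x. N \<le> n \<Longrightarrow> x \<in> U n \<Longrightarrow> norm (p n x - f x) < e"
      using lim[of e] unfolding eventually_sequentially by blast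
    have "dist (q n x) (g x) < e" if "N \<le> n" for n x
    proof (cases "\<exists>m. x \<in> U m")
      case True
      then obtain m where m: "x \<in> U m" by blast
      show ?thesis
      proof (cases "m < n")
        case True
        then show ?thesis using m q_lt g_U \<open>0 < e\<close> by simp
      next
        case False
        have "x \<notin> U i" if "i < n" for i
          using the[OF m] the[of x i] that False by auto
        then have "q n x = f x" by (rule q_ge)
        then show ?thesis
          using N[of m x] m False that g_U[OF m] by (simp add: dist_norm norm_minus_commute)
      qed
    next
      case False
      then show ?thesis using q_ge[of n x] \<open>0 < e\<close> by (simp add: g_def)
    qed
    then show "\<forall>\<^sub>F n in sequentially. \<forall>x\<in>topspace X. g x \<in> UNIV \<and> dist (q n x) (g x) < e"
      unfolding eventually_sequentially by blast
  qed (use q_cont in auto)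
  then have "restrict g (topspace X) \<in> cont_funs X"
    by (intro restrict_in_cont_funs) simp
  moreover have "restrict g (topspace X) x = p n x" if "x \<in> U n" for n x
    using g_U[OF that] that clopen_in_subset[OF U] by auto
  ultimately show ?thesis by (rule that)
qed

text \<open>
  Otherwise some subsequence has points \<open>x k\<close>, converging to a point \<open>l\<close>, at which the functions have
  norm at least \<open>e\<close>. If \<open>E\<close> contains every second index of it, the function \<open>G\<close> for this \<open>E\<close>
  alternates along the sequence between \<open>0\<close> and norm at least \<open>e\<close>, so \<open>G\<close> is not continuous at \<open>l\<close>.
\<close>
lemma uniformly_null_if_subfamilies_glue:
  fixes b :: "nat \<Rightarrow> 'a \<Rightarrow> 'k::real_normed_field"
  assumes X: "sequentially_compact_space X"
    and off: "\<And>n x. x \<in> topspace X \<Longrightarrow> x \<notin> U n \<Longrightarrow> b n x = 0"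
    and glue: "\<And>E. \<exists>G\<in>cont_funs X. \<forall>n. \<forall>x\<in>topspace X \<inter> U n. G x = (if n \<in> E then b n x else 0)"
    and e: "0 < e"
  shows "\<forall>\<^sub>F n in sequentially. \<forall>x\<in>topspace X. norm (b n x) < e"
proof (rule ccontr)
  let ?bad = "{n. \<exists>x\<in>topspace X. e \<le> norm (b n x)}"
  assume "\<not> ?thesis"
  then have "infinite ?bad"
    unfolding eventually_sequentially infinite_nat_iff_unbounded_le by (auto simp: not_less)
  then obtain s :: "nat \<Rightarrow> nat" where s: "strict_mono s" "\<And>k. s k \<in> ?bad"
    using infinite_enumerate by blast
  then obtain x where x: "\<And>k. x k \<in> topspace X" "\<And>k. e \<le> norm (b (s k) (x k))"
    by simp metis
  then obtain l r where r: "strict_mono r" and lim: "limitin X (x \<circ> r) l sequentially"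
    using X unfolding sequentially_compact_space_def by blast
  have xU: "x k \<in> U (s k)" for k
    using x(1)[of k] x(2)[of k] off e by force
  define E where "E = {s (r (2 * j)) | j. True}"
  obtain G where G: "G \<in> cont_funs X"
    "\<And>n z. z \<in> topspace X \<Longrightarrow> z \<in> U n \<Longrightarrow> G z = (if n \<in> E then b n z else 0)"
    using glue[of E] by blast
  have Gx: "G (x (r k)) = (if s (r k) \<in> E then b (s (r k)) (x (r k)) else 0)" for k
    by (intro G(2) x xU)
  have inE: "s (r k) \<in> E \<longleftrightarrow> even k" for k
  proof -
    have "s (r k) = s (r j) \<longleftrightarrow> k = j" for j
      using s(1) r by (simp add: strict_mono_eq)
    then show ?thesis by (auto simp: E_def)
  qed
  have conv: "(\<lambda>k. G (x (r k))) \<longlonglongrightarrow> G l"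
    using continuous_map_limit[OF cont_funs_continuous[OF G(1)] lim] by (simp add: o_def)
  have "(\<lambda>k. G (x (r (2 * k + 1)))) \<longlonglongrightarrow> G l" "(\<lambda>k. G (x (r (2 * k)))) \<longlonglongrightarrow> G l"
    using LIMSEQ_subseq_LIMSEQ[OF conv, of "\<lambda>k. 2 * k + 1"]
      LIMSEQ_subseq_LIMSEQ[OF conv, of "\<lambda>k. 2 * k"]
    by (auto simp: o_def strict_mono_def)
  then have "(\<lambda>k. 0) \<longlonglongrightarrow> G l" and even: "(\<lambda>k. norm (G (x (r (2 * k))))) \<longlonglongrightarrow> norm (G l)"
    by (auto simp: Gx inE intro: tendsto_norm)
  then have "G l = 0" by (simp add: LIMSEQ_const_iff)
  moreover have "e \<le> norm (G l)"
    by (rule LIMSEQ_le_const[OF even]) (use x(2) in \<open>auto simp: Gx inE\<close>)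
  ultimately show False using e by simp
qed

section \<open>Norm continuity\<close>

context compat_iso
begin

lemma disjoint_clopens_pullback:
  assumes V: "\<And>n. clopen_in Y (V n)" and dis: "disjoint_family V"
  obtains U where "\<And>n. clopen_in X (U n)" "disjoint_family U"
    "\<And>n. \<forall>g\<in>cont_funs Y. S (cut_to Y (V n) g) = cut_to X (U n) (S g)"
    "\<And>n. \<forall>f\<in>cont_funs X. T (cut_to X (U n) f) = cut_to Y (V n) (T f)"
proof -
  have "\<forall>n. \<exists>U. clopen_in X U \<and> (\<forall>g\<in>cont_funs Y. S (cut_to Y (V n) g) = cut_to X U (S g))"
    using S_cut_to[OF V] by metis
  then obtain U where U: "\<And>n. clopen_in X (U n)"
    and SV: "\<And>n g. g \<in> cont_funs Y \<Longrightarrow> S (cut_to Y (V n) g) = cut_to X (U n) (S g)"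
    by metis
  have TU: "T (cut_to X (U n) f) = cut_to Y (V n) (T f)" if "f \<in> cont_funs X" for n f
    using SV[of "T f" n] T_S[of "cut_to Y (V n) (T f)"] that
    by (simp add: T_in S_T cut_to_in_cont_funs V)
  have "U m \<inter> U n = {}" if "m \<noteq> n" for m n
  proof -
    have VV: "V m \<inter> V n = {}"
      using dis that by (auto simp: disjoint_family_on_def)
    let ?w = "T (const_on X (1::'k))"
    have w: "?w \<in> cont_funs Y" by (intro T_in const_on_in_cont_funs)
    have "cut_to Y (V m) (cut_to Y (V n) ?w) = const_on Y 0"
      using VV by (intro cont_funs_eqI[where X=Y] cut_to_in_cont_funs V w const_on_in_cont_funs) auto
    then have "cut_to X (U m) (cut_to X (U n) (S ?w)) = S (const_on Y 0)"
      using SV[of "cut_to Y (V n) ?w" m] SV[OF w, of n] by (simp add: cut_to_in_cont_funs V w)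
    also have "\<dots> = const_on X 0"
      by (rule compat_iso.T_zero[OF inverse])
    finally have *: "cut_to X (U m) (cut_to X (U n) (const_on X 1)) = const_on X (0::'k)"
      by (simp add: S_T const_on_in_cont_funs)
    have False if "x \<in> U m" "x \<in> U n" for x
      using fun_cong[OF *, of x] that clopen_in_subset[OF U[of m]] by auto
    then show ?thesis by blast
  qed
  then have "disjoint_family U" by (simp add: disjoint_family_on_def)
  then show ?thesis using that[of U] U SV TU by blast
qed

lemma T_local:
  assumes U: "clopen_in X U" and V: "clopen_in Y V"
    and TU: "\<forall>f\<in>cont_funs X. T (cut_to X U f) = cut_to Y V (T f)"
    and ab: "a \<in> cont_funs X" "b \<in> cont_funs X" "\<And>x. x \<in> U \<Longrightarrow> a x = b x"
    and y: "y \<in> V"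
  shows "T a y = T b y"
proof -
  have "cut_to X U a = cut_to X U b"
    using ab by (intro cont_funs_eqI[where X=X] cut_to_in_cont_funs U) auto
  then have "cut_to Y V (T a) = cut_to Y V (T b)"
    using TU ab by (metis (no_types))
  from fun_cong[OF this, of y] show ?thesis
    using y clopen_in_subset[OF V] by auto
qed

text \<open>
  The core of the proof, carried out for a sequence \<open>F\<close> converging uniformly to \<open>f\<close>. In the notation
  of the introduction, \<open>B k n\<close> is \<open>k \<beta>\<^sub>n\<close> and \<open>b k n\<close> is its image under \<open>S\<close>. The factor \<open>k\<close> is
  essential: it lets images that are small in \<open>X\<close> come from functions that are arbitrarily large
  in \<open>Y\<close>.
\<close>
lemma no_uniform_jump:
  assumes X: "sequentially_compact_space X" and Y: "compact_space Y"
    and split: "clopens_split_opens Y"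
    and f: "f \<in> cont_funs X" and F: "\<And>n. F n \<in> cont_funs X"
    and lim: "\<And>e. 0 < e \<Longrightarrow> \<forall>\<^sub>F n in sequentially. \<forall>x\<in>topspace X. norm (F n x - f x) < e"
    and \<epsilon>: "0 < \<epsilon>" and jump: "\<And>n. \<exists>y\<in>topspace Y. \<epsilon> < norm (T (F n) y - T f y)"
  shows False
proof -
  define A where "A n = {y \<in> topspace Y. norm (T (F n) y - T f y) \<in> {\<epsilon><..}}" for n
  have "continuous_map Y euclidean (\<lambda>y. norm (T (F n) y - T f y))" for n
    by (intro continuous_map_norm continuous_map_diff cont_funs_continuous[OF T_in] F f)
  then have A_open: "openin Y (A n)" for n
    unfolding A_def by (rule openin_continuous_map_preimage) (simp add: open_greaterThan)
  have A_ne: "A n \<noteq> {}" for n using jump[of n] by (auto simp: A_def)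
  obtain r :: "nat \<Rightarrow> nat" and V where r: "strict_mono r" and V: "\<And>k. clopen_in Y (V k)" "disjoint_family V"
    and AV: "\<And>k. A (r k) \<inter> V k \<noteq> {}"
    by (rule disjoint_clopens_meeting_opens[where A=A, OF split A_open A_ne]) (rule that)
  define y where "y n = (SOME z. z \<in> A (r n) \<inter> V n)" for n
  have "y n \<in> A (r n) \<inter> V n" for n
    unfolding y_def by (rule someI_ex) (use AV[of n] in blast)
  then have y: "\<And>n. y n \<in> A (r n)" "\<And>n. y n \<in> V n" by blast+
  obtain U where U: "\<And>n. clopen_in X (U n)" "disjoint_family U"
    and SV: "\<And>n. \<forall>g\<in>cont_funs Y. S (cut_to Y (V n) g) = cut_to X (U n) (S g)"
    and TU: "\<And>n. \<forall>f\<in>cont_funs X. T (cut_to X (U n) f) = cut_to Y (V n) (T f)"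
    by (rule disjoint_clopens_pullback[OF V]) (rule that)
  note T_local' = T_local[OF U(1) V(1) TU]
  note S_local' = compat_iso.T_local[OF inverse V(1) U(1) SV]

  \<comment> \<open>Truncation at height \<open>k\<close>: differences larger than \<open>\<epsilon>\<close> become exactly \<open>k\<close> in norm.\<close>
  define \<phi> :: "nat \<Rightarrow> 'k \<Rightarrow> 'k" where "\<phi> k z = of_nat k * of_real (min (norm z / \<epsilon>) 1)" for k z
  have \<phi>0: "\<phi> k 0 = 0" for k by (simp add: \<phi>_def)
  have \<phi>_norm: "norm (\<phi> k z) = k" if "\<epsilon> < norm z" for k z
    using that \<epsilon> by (simp add: \<phi>_def norm_mult)
  define h where "h k a = (\<lambda>y\<in>topspace Y. \<phi> k (T a y - T f y))" for k a
  have h: "h k a \<in> cont_funs Y" if "a \<in> cont_funs X" for k a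
  proof -
    have "continuous_map Y euclidean (\<phi> k \<circ> (\<lambda>y. T a y - T f y))"
    proof (rule continuous_map_compose)
      show "continuous_map Y euclidean (\<lambda>y. T a y - T f y)"
        by (intro continuous_map_diff cont_funs_continuous T_in that f)
      have "continuous_on UNIV (\<phi> k)"
        unfolding \<phi>_def by (intro continuous_intros) (use \<epsilon> in auto)
      then show "continuous_map euclidean euclidean (\<phi> k)" by simp
    qed
    then show ?thesis unfolding h_def by (intro restrict_in_cont_funs) (simp add: o_def)
  qed
  define B where "B k n = cut_to Y (V n) (h k (F (r n)))" for k n
  have B: "B k n \<in> cont_funs Y" for k n
    unfolding B_def by (intro cut_to_in_cont_funs V h F)
  define b where "b k n = S (B k n)" for k n
  have b: "b k n \<in> cont_funs X" for k n
    unfolding b_def by (intro S_in B)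
  have b_off: "b k n x = 0" if "x \<in> topspace X" "x \<notin> U n" for k n x
    using that SV[rule_format, OF h[OF F]] by (simp add: b_def B_def)

  \<comment> \<open>For each \<open>E\<close>, the pullback of one continuous function on \<open>Y\<close> glues the \<open>b k n\<close> with \<open>n \<in> E\<close>.\<close>
  have null: "\<forall>\<^sub>F n in sequentially. \<forall>x\<in>topspace X. norm (b k n x) < e" if "0 < e" for k e
  proof (rule uniformly_null_if_subfamilies_glue[OF X b_off _ that])
    fix E
    define p where "p n = (if n \<in> E then F (r n) else f)" for n
    have p: "p n \<in> cont_funs X" for n using F f by (simp add: p_def)
    have "\<forall>\<^sub>F n in sequentially. \<forall>x\<in>U n. norm (p n x - f x) < e" if "0 < e" for e
    proof -
      have "\<forall>\<^sub>F n in sequentially. \<forall>x\<in>topspace X. norm (F (r n) x - f x) < e"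
        using eventually_subseq[OF r lim[OF that]] by simp
      then show ?thesis
        by eventually_elim (use that clopen_in_subset[OF U(1)] in \<open>auto simp: p_def\<close>)
    qed
    then obtain g where g: "g \<in> cont_funs X" "\<And>n x. x \<in> U n \<Longrightarrow> g x = p n x"
      by (rule glue_on_disjoint_clopens[OF U f p]) (assumption, rule that)
    have Tg: "T g z = T (p n) z" if "z \<in> V n" for n z
      by (rule T_local'[OF g(1) p g(2) that])
    have "S (h k g) x = (if n \<in> E then b k n x else 0)" if "x \<in> U n" for n x
    proof (cases "n \<in> E")
      case True
      have "S (h k g) x = S (B k n) x"
      proof (rule S_local'[OF h[OF g(1)] B _ that])
        fix z assume z: "z \<in> V n"
        then have "z \<in> topspace Y" using clopen_in_subset[OF V(1)] by blast
        then show "h k g z = B k n z"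
          using z True by (simp add: h_def B_def Tg p_def)
      qed
      then show ?thesis using True by (simp add: b_def)
    next
      case False
      have "S (h k g) x = S (const_on Y 0) x"
      proof (rule S_local'[OF h[OF g(1)] const_on_in_cont_funs _ that])
        fix z assume z: "z \<in> V n"
        then have "z \<in> topspace Y" using clopen_in_subset[OF V(1)] by blast
        then show "h k g z = const_on Y 0 z"
          using z False by (simp add: h_def Tg p_def \<phi>0)
      qed
      also have "\<dots> = 0"
        using that clopen_in_subset[OF U(1)[of n]] compat_iso.T_zero[OF inverse]
        by (simp add: subset_iff)
      finally show ?thesis using False by simp
    qed
    then show "\<exists>G\<in>cont_funs X. \<forall>n. \<forall>x\<in>topspace X \<inter> U n. G x = (if n \<in> E then b k n x else 0)"
      using S_in[OF h[OF g(1)]] by blast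
  qed

  \<comment> \<open>A diagonal choice \<open>s\<close> makes the heights \<open>k\<close> grow while the pullbacks tend to \<open>0\<close>.\<close>
  define small where "small k n \<longleftrightarrow> (\<forall>x\<in>topspace X. norm (b k n x) < inverse (Suc k))" for k n
  have next_small: "\<exists>n>N. small k n" for k N
  proof -
    have "\<forall>\<^sub>F n in sequentially. small k n"
      unfolding small_def by (rule null) simp
    then have "\<forall>\<^sub>F n in sequentially. small k n \<and> N < n"
      by (intro eventually_conj eventually_gt_at_top)
    then show ?thesis
      using eventually_happens'[OF sequentially_bot] by blast
  qed
  then obtain s where s: "\<And>k. small k (s k)" "\<And>k. s k < s (Suc k)"
  proof -
    have "\<exists>s. \<forall>k. small k (s k) \<and> s k < s (Suc k)"
      by (rule dependent_nat_choice) (use next_small in blast)+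
    then show ?thesis using that by blast
  qed
  have "strict_mono s" using s(2) by (simp add: strict_mono_Suc_iff)
  then have inj: "inj s" by (rule strict_mono_imp_inj_on)
  then have Us: "disjoint_family (\<lambda>k. U (s k))"
    using U(2) by (simp add: disjoint_family_on_def inj_eq)
  have "\<forall>\<^sub>F k in sequentially. \<forall>x\<in>U (s k). norm (b k (s k) x - const_on X 0 x) < e" if "0 < e" for e
  proof -
    have "\<forall>\<^sub>F k in sequentially. inverse (real (Suc k)) < e"
      using order_tendstoD(2)[OF LIMSEQ_inverse_real_of_nat that] .
    then show ?thesis
    proof eventually_elim
      case (elim k)
      show ?case
      proof
        fix x assume "x \<in> U (s k)"
        then have "x \<in> topspace X" using clopen_in_subset[OF U(1)] by blast
        then show "norm (b k (s k) x - const_on X 0 x) < e"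
          using s(1)[of k] elim by (force simp: small_def)
      qed
    qed
  qed
  then obtain G where G: "G \<in> cont_funs X" "\<And>k x. x \<in> U (s k) \<Longrightarrow> G x = b k (s k) x"
    by (rule glue_on_disjoint_clopens[OF U(1) Us const_on_in_cont_funs b]) (assumption, rule that)
  have y_top: "y n \<in> topspace Y" for n using y(1) by (auto simp: A_def)
  have TG: "norm (T G (y (s k))) = k" for k
  proof -
    have "T G (y (s k)) = T (b k (s k)) (y (s k))"
      by (rule T_local'[OF G(1) b G(2) y(2)])
    also have "\<dots> = B k (s k) (y (s k))"
      by (simp add: b_def T_S B)
    also have "\<dots> = \<phi> k (T (F (r (s k))) (y (s k)) - T f (y (s k)))"
      using y(2) y_top by (simp add: B_def h_def)
    finally show ?thesis
      using y(1)[of "s k"] by (auto simp: A_def intro: \<phi>_norm)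
  qed
  have "compactin euclidean (T G ` topspace Y)"
    using image_compactin[OF _ cont_funs_continuous[OF T_in[OF G(1)]], of "topspace Y"] Y
    by (simp add: compact_space_def)
  then have "bounded (T G ` topspace Y)"
    by (simp add: compact_imp_bounded)
  then obtain C where "\<And>z. z \<in> topspace Y \<Longrightarrow> norm (T G z) \<le> C"
    by (auto simp: bounded_iff)
  then have "real k \<le> C" for k
    using TG[of k] y_top[of "s k"] by metis
  then show False
    using reals_Archimedean2[of C] by (metis not_less)
qed

end

theorem compat_isomorphism_continuous:
  fixes X :: "'a topology" and Y :: "'b topology"
    and T :: "('a \<Rightarrow> 'k::real_normed_field) \<Rightarrow> 'b \<Rightarrow> 'k"
  assumes X: "compact_space X" "Hausdorff_space X"
    and Y: "compact_space Y" "Hausdorff_space Y"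
    and seq: "sequentially_compact_space X"
    and nd: "\<forall>K \<in> connected_components_of X. nowhere_dense_in X K"
    and T: "compat_isomorphism X Y T"
  shows "continuous_map (sup_norm_topology X) (sup_norm_topology Y) T"
proof -
  interpret compat_iso X Y T "inv_into (cont_funs X) T"
    by (rule compat_iso_of_compat_isomorphism[OF T])
  let ?mX = "cfunspace X (euclidean_metric :: 'k metric)"
  let ?mY = "cfunspace Y (euclidean_metric :: 'k metric)"
  have MX: "mspace ?mX = cont_funs X" and MY: "mspace ?mY = cont_funs Y"
    using X Y by (simp_all only: mspace_cfunspace_eq_cont_funs)
  have split: "clopens_split_opens Y"
    by (rule clopens_split_opens_transfer[OF clopens_split_opens_if_nowhere_dense[OF X nd] Y])
  have "\<exists>\<delta>>0. \<forall>g. g \<in> cont_funs X \<and> mdist ?mX f g < \<delta> \<longrightarrow> mdist ?mY (T f) (T g) < \<epsilon>"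
    if f: "f \<in> cont_funs X" and \<epsilon>: "0 < \<epsilon>" for f \<epsilon>
  proof (rule ccontr)
    assume no: "\<not> ?thesis"
    have "\<exists>g. g \<in> cont_funs X \<and> mdist ?mX f g < inverse (Suc n) \<and> \<not> mdist ?mY (T f) (T g) < \<epsilon>" for n
      using no by (metis inverse_positive_iff_positive of_nat_0_less_iff zero_less_Suc)
    then obtain F where F: "\<And>n. F n \<in> cont_funs X"
      and close: "\<And>n. mdist ?mX f (F n) < inverse (Suc n)"
      and far: "\<And>n. \<not> mdist ?mY (T f) (T (F n)) < \<epsilon>" by metis
    have le: "norm (F n x - f x) \<le> inverse (Suc n)" if "x \<in> topspace X" for n x
      using mdist_cfunspace_imp_mdist_le[of f X euclidean_metric "F n" "inverse (Suc n)" x] f F close[of n] that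
      unfolding MX by (simp add: dist_norm norm_minus_commute less_imp_le)
    have lim: "\<forall>\<^sub>F n in sequentially. \<forall>x\<in>topspace X. norm (F n x - f x) < e" if "0 < e" for e
      using order_tendstoD(2)[OF LIMSEQ_inverse_real_of_nat that]
    proof eventually_elim
      case (elim n)
      then show ?case using le[of _ n] le_less_trans by blast
    qed
    have jump: "\<exists>y\<in>topspace Y. \<epsilon> / 2 < norm (T (F n) y - T f y)" for n
    proof (rule ccontr)
      assume "\<not> ?thesis"
      then have "mdist ?mY (T f) (T (F n)) \<le> \<epsilon> / 2"
        using \<epsilon> by (intro mdist_cfunspace_le) (auto simp: dist_norm norm_minus_commute not_less)
      then show False using far[of n] \<epsilon> by simp
    qed
    show False
      using \<epsilon> by (intro no_uniform_jump[OF seq Y(1) split f F lim _ jump]) auto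
  qed
  then have "\<forall>f\<in>mspace ?mX. \<forall>\<epsilon>>0. \<exists>\<delta>>0. \<forall>g. g \<in> mspace ?mX \<and> mdist ?mX f g < \<delta> \<longrightarrow>
      mdist ?mY (T f) (T g) < \<epsilon>"
    unfolding MX by blast
  moreover have "T ` mspace ?mX \<subseteq> mspace ?mY"
    unfolding MX MY using T_in by blast
  ultimately show ?thesis
    unfolding mtopology_of_def
    by (simp only: Metric_space.metric_continuous_map[OF Metric_space_mspace_mdist Metric_space_mspace_mdist])
qed

theorem theorem1p2:
  fixes X :: "'a topology" and Y :: "'b topology"
  assumes "compact_space X" and "Hausdorff_space X"
    and "compact_space Y" and "Hausdorff_space Y"
    and "sequentially_compact_space X"
    and "\<forall>K \<in> connected_components_of X. nowhere_dense_in X K"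
  shows "(\<forall>T :: ('a \<Rightarrow> real) \<Rightarrow> ('b \<Rightarrow> real).
            compat_isomorphism X Y T \<longrightarrow>
            continuous_map (sup_norm_topology X) (sup_norm_topology Y) T) \<and>
         (\<forall>T :: ('a \<Rightarrow> complex) \<Rightarrow> ('b \<Rightarrow> complex).
            compat_isomorphism X Y T \<longrightarrow>
            continuous_map (sup_norm_topology X) (sup_norm_topology Y) T)"
  by (intro conjI allI impI compat_isomorphism_continuous[OF assms])

end
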